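(* Let $\boldsymbol{u}=(2,3,\ldots,n,n+1)$. If $I=\{i_1,i_2,\ldots,i_k\}$ is a lucky set of $\mathrm{PF}(\boldsymbol{u})$ with $k\ge 1$ and $1\le i_1<\cdots<i_k\le n$, then $$|\mathcal{O}_{\boldsymbol{u}}(I)|=k!\prod_{j\in[n]\setminus I}\big(|I\cap[j]|+1\big)=2^{i_2-i_1}\,3^{i_3-i_2}\cdots k^{i_k-i_{k-1}}\,(k+1)^{n-i_k},$$ where the last expression means $\Big(\prod_{\ell=2}^{k}\ell^{\,i_\ell-i_{\ell-1}}\Big)(k+1)^{n-i_k}$.
   Context: Notation: $[n]=\{1,\dots,n\}$, $\mathbb{N}=\{1,2,\dots\}$. For a weakly increasing vector $\boldsymbol{u}=(u_1,\dots,u_n)$ of positive integers, spot $i\in\mathbb{N}$ on a one-way street has capacity $m_i(\boldsymbol{u})$, the number of times $i$ occurs in $\boldsymbol{u}$. Cars $1,\dots,n$ enter in this order with preferences $\boldsymbol{a}=(a_1,\dots,a_n)\in\mathbb{N}^n$; car $c$ parks in the first spot $j\ge a_c$ in which fewer than $m_j(\boldsymbol{u})$ cars are already parked, and fails to park if there is none. $\boldsymbol{a}$ is a $\boldsymbol{u}$-parking function if all cars park; $\mathrm{PF}(\boldsymbol{u})$ is the set of these. The outcome of $\boldsymbol{a}\in\mathrm{PF}(\boldsymbol{u})$ is $\mathcal{O}_{\boldsymbol{u}}(\boldsymbol{a})=B_1B_2\cdots B_M$ with $M=\max(\boldsymbol{u})$, where $B_i$ is the set of cars parked in spot $i$ if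 $m_i(\boldsymbol{u})>0$, and $B_i=\mathtt{X}$ if $m_i(\boldsymbol{u})=0$. A car is lucky if it parks in its preferred spot; $\mathsf{Lucky}_{\boldsymbol{u}}(\boldsymbol{a})$ is the set of lucky cars. A set $I\subseteq[n]$ is a lucky set of $\mathrm{PF}(\boldsymbol{u})$ if $I=\mathsf{Lucky}_{\boldsymbol{u}}(\boldsymbol{a})$ for some $\boldsymbol{a}\in\mathrm{PF}(\boldsymbol{u})$, and $\mathcal{O}_{\boldsymbol{u}}(I)=\{\mathcal{O}_{\boldsymbol{u}}(\boldsymbol{a}):\boldsymbol{a}\in\mathrm{PF}(\boldsymbol{u}),\ \mathsf{Lucky}_{\boldsymbol{u}}(\boldsymbol{a})=I\}$. *)

theory Defs
  imports Main
begin

text \<open>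
  Throughout, \<open>u\<close> is the (weakly increasing) list of positive integers encoding the
  capacities, and \<open>a\<close> is the list of preferences. Lists are indexed from 0 whereas cars and spots
  are numbered from 1, so car \<open>c\<close> has preference \<open>a ! (c - 1)\<close>.
\<close>

definition capacity :: "nat list \<Rightarrow> nat \<Rightarrow> nat" where
  "capacity u i = count_list u i"

text \<open>
  \<open>ps\<close> records where the cars that have already entered are parked, in order of arrival
  (\<open>None\<close> for a car that failed to park).
\<close>

definition available :: "nat list \<Rightarrow> nat option list \<Rightarrow> nat \<Rightarrow> bool" where
  "available u ps j \<longleftrightarrow> count_list ps (Some j) < capacity u j"

definition park_car :: "nat list \<Rightarrow> nat option list \<Rightarrow> nat \<Rightarrow> nat option" where
  "park_car u ps p =
     (if \<exists>j\<ge>p. available u ps j then Some (LEAST j. p \<le> j \<and> available u ps j) else None)"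

definition parking :: "nat list \<Rightarrow> nat list \<Rightarrow> nat option list" where
  "parking u a = foldl (\<lambda>ps p. ps @ [park_car u ps p]) [] a"

definition PF :: "nat list \<Rightarrow> nat list set" where
  "PF u = {a. length a = length u \<and> (\<forall>p\<in>set a. 1 \<le> p) \<and> None \<notin> set (parking u a)}"

text \<open>In an outcome \<open>B\<^sub>1B\<^sub>2\<dots>B\<^sub>M\<close>, the symbol \<open>X\<close> for a spot of capacity 0 is encoded as \<open>None\<close>.\<close>

definition outcome :: "nat list \<Rightarrow> nat list \<Rightarrow> nat set option list" where
  "outcome u a =
     map (\<lambda>i. if capacity u i > 0
              then Some {c \<in> {1..length u}. parking u a ! (c - 1) = Some i}
              else None)
       [1..<Suc (Max (set u))]"

definition Lucky :: "nat list \<Rightarrow> nat list \<Rightarrow> nat set" where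
  "Lucky u a = {c \<in> {1..length u}. parking u a ! (c - 1) = Some (a ! (c - 1))}"

definition lucky_set :: "nat list \<Rightarrow> nat set \<Rightarrow> bool" where
  "lucky_set u I \<longleftrightarrow> (\<exists>a\<in>PF u. I = Lucky u a)"

definition outcomes :: "nat list \<Rightarrow> nat set \<Rightarrow> nat set option list set" where
  "outcomes u I = {outcome u a | a. a \<in> PF u \<and> Lucky u a = I}"

end

theory Submission
  imports Defs
begin

text \<open>
  The street has spots \<open>2, \<dots>, n + 1\<close> of capacity 1, preceded by spot 1 of capacity 0, so an outcome
  amounts to a permutation of the cars \<open>1, \<dots>, n\<close>, read along the street. In a given permutation
  any car can be made lucky by letting it prefer the spot where it ends up. A car can be made
  unlucky exactly if the spot just before its own is unavailable when it arrives: that spot is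
  spot 1, or it holds an earlier car; preferring that spot then suffices. Hence the outcomes
  with lucky set \<open>I\<close> are the permutations in which every car outside \<open>I\<close> stands first or has a
  smaller left neighbour, that is, in which every descent ends in a member of \<open>I\<close>
  (\<open>outcome_in_arrangements\<close>, \<open>arrangement_is_outcome\<close>).

  These permutations are counted by inserting the largest car \<open>n + 1\<close> into a permutation of
  \<open>1, \<dots>, n\<close>. Its own left neighbour is always smaller, while its right neighbour now follows a
  descent. So, whether or not \<open>n + 1\<close> lies in \<open>I\<close>, it may be put at the end or directly before a
  member of \<open>I\<close>, and nowhere else. Conversely, removing \<open>n + 1\<close> creates no forbidden descent, as the
  car after it belongs to \<open>I\<close>. The number of permutations is therefore the product over
  \<open>j \<le> n\<close> of \<open>|I \<inter> {1..<j}| + 1\<close> (\<open>card_arrangements\<close>).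

  Both closed forms are regroupings of this product. The factors at the members of \<open>I\<close> are
  \<open>1, 2, \<dots>, k\<close> and multiply to \<open>k!\<close>, and at a non-member \<open>j\<close> one may replace \<open>{1..<j}\<close> by \<open>{1..j}\<close>
  (\<open>fact_times_prod_non_members\<close>). On the other hand the factor is constantly \<open>l\<close> on the
  block \<open>i\<^sub>l\<^sub>-\<^sub>1 < j \<le> i\<^sub>l\<close>, starting with \<open>1\<close> for \<open>j \<le> i\<^sub>1\<close>, and \<open>k + 1\<close> beyond \<open>i\<^sub>k\<close>
  (\<open>prod_grouped\<close>).
\<close>

section \<open>Arrangements whose descents end in a prescribed set\<close>

definition arrangements :: "nat set \<Rightarrow> nat \<Rightarrow> nat list set" where
  "arrangements I n =
     {xs. distinct xs \<and> set xs = {1..n} \<and> successively (\<lambda>a b. b \<in> I \<or> a < b) xs}"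

text \<open>
  If \<open>y\<close> does not occur in \<open>xs\<close>, the new element is appended at the end. As all cars are
  positive, \<open>y = 0\<close> serves below as the code for that choice.
\<close>

definition insert_before :: "nat \<Rightarrow> nat \<Rightarrow> nat list \<Rightarrow> nat list" where
  "insert_before m y xs = takeWhile (\<lambda>x. x \<noteq> y) xs @ m # dropWhile (\<lambda>x. x \<noteq> y) xs"

lemma set_insert_before [simp]: "set (insert_before m y xs) = insert m (set xs)"
  unfolding insert_before_def
  by (metis set_append list.set(2) Un_insert_right takeWhile_dropWhile_id)

lemma distinct_insert_before:
  assumes "distinct xs" "m \<notin> set xs"
  shows "distinct (insert_before m y xs)"
proof -
  let ?p = "takeWhile (\<lambda>x. x \<noteq> y) xs" and ?q = "dropWhile (\<lambda>x. x \<noteq> y) xs"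
  have "distinct (?p @ ?q)" "m \<notin> set (?p @ ?q)" using assms by simp_all
  then show ?thesis
    unfolding insert_before_def distinct_append set_append by simp
qed

lemma remove1_insert_before: "m \<notin> set xs \<Longrightarrow> remove1 m (insert_before m y xs) = xs"
  unfolding insert_before_def by (auto simp: remove1_append dest: set_takeWhileD)

text \<open>
  The only new adjacent pairs are an ascent into \<open>Suc n\<close> and, unless \<open>Suc n\<close> comes last, a descent
  from it; this descent ends at \<open>y\<close>, which was chosen in \<open>I\<close>.
\<close>

lemma insert_before_arrangement:
  assumes "xs \<in> arrangements I n" "y \<in> insert 0 (I \<inter> {1..n})"
  shows "insert_before (Suc n) y xs \<in> arrangements I (Suc n)"
proof -
  define p q where "p = takeWhile (\<lambda>x. x \<noteq> y) xs" and "q = dropWhile (\<lambda>x. x \<noteq> y) xs"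
  have xs: "xs = p @ q" by (simp add: p_def q_def)
  have ins: "insert_before (Suc n) y xs = p @ Suc n # q"
    by (simp add: insert_before_def p_def q_def)
  have D: "distinct xs" "set xs = {1..n}" and S: "successively (\<lambda>a b. b \<in> I \<or> a < b) (p @ q)"
    using assms(1) by (auto simp: arrangements_def xs)
  have hq: "q \<noteq> [] \<Longrightarrow> hd q = y"
    unfolding q_def by (metis (mono_tags, lifting) hd_dropWhile)
  have "q \<noteq> [] \<Longrightarrow> y \<in> set xs" using hq xs by (metis Un_iff list.set_sel(1) set_append)
  then have hI: "q \<noteq> [] \<Longrightarrow> hd q \<in> I" using hq assms(2) D by auto
  have "last p < Suc n" if "p \<noteq> []"
    using that D(2) xs by (metis Un_iff atLeastAtMost_iff last_in_set le_imp_less_Suc set_append)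
  then have "successively (\<lambda>a b. b \<in> I \<or> a < b) (p @ Suc n # q)"
    using S hI by (auto simp: successively_append_iff successively_Cons)
  then show ?thesis
    using distinct_insert_before[of xs "Suc n" y] D
    by (simp add: arrangements_def atLeastAtMostSuc_conv flip: ins)
qed

text \<open>
  The successor of the largest element ends a descent, hence lies in \<open>I\<close>; it therefore remains
  admissible after any left neighbour once the largest element is removed.
\<close>

lemma arrangement_remove_max:
  assumes "zs \<in> arrangements I (Suc n)"
  shows "\<exists>xs \<in> arrangements I n. \<exists>y \<in> insert 0 (I \<inter> {1..n}). zs = insert_before (Suc n) y xs"
proof -
  have D: "distinct zs" "set zs = {1..Suc n}" and S: "successively (\<lambda>a b. b \<in> I \<or> a < b) zs"
    using assms by (auto simp: arrangements_def)
  then have "Suc n \<in> set zs" by simp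
  then obtain p q where zs: "zs = p @ Suc n # q" by (meson split_list)
  have set_pq: "set (p @ q) = {1..n}"
  proof -
    have "Suc n \<notin> set (p @ q)" using D(1) unfolding zs by simp
    then have "set (p @ q) = set zs - {Suc n}" unfolding zs by simp
    also have "\<dots> = {1..n}" unfolding D(2) by auto
    finally show ?thesis .
  qed
  define y where "y = (if q = [] then 0 else hd q)"
  have hd_q: "hd q \<in> I" if "q \<noteq> []"
  proof -
    have "hd q \<in> I \<or> Suc n < hd q"
      using S that zs by (auto simp: successively_append_iff successively_Cons)
    moreover have "hd q \<in> {1..n}" using that set_pq by (metis Un_iff list.set_sel(1) set_append)
    ultimately show ?thesis by auto
  qed
  have "successively (\<lambda>a b. b \<in> I \<or> a < b) (p @ q)"
    using S hd_q unfolding zs successively_append_iff successively_Cons by force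
  moreover have "distinct (p @ q)" using D(1) zs by simp
  ultimately have "p @ q \<in> arrangements I n"
    using set_pq unfolding arrangements_def by blast
  moreover have "y \<in> insert 0 (I \<inter> {1..n})"
  proof (cases "q = []")
    case True
    then show ?thesis by (simp add: y_def)
  next
    case False
    then have "hd q \<in> {1..n}" unfolding set_pq[symmetric] by simp
    then show ?thesis using hd_q False by (simp add: y_def)
  qed
  moreover have "zs = insert_before (Suc n) y (p @ q)"
  proof -
    have y_notin: "y \<notin> set p"
    proof (cases "q = []")
      case True
      then show ?thesis using set_pq by (auto simp: y_def)
    next
      case False
      then have "y \<in> set q" by (simp add: y_def)
      then show ?thesis using D(1) zs by auto
    qed
    have q: "takeWhile (\<lambda>x. x \<noteq> y) q = []" "dropWhile (\<lambda>x. x \<noteq> y) q = q"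
      by (cases q; simp add: y_def)+
    have "takeWhile (\<lambda>x. x \<noteq> y) (p @ q) = p @ takeWhile (\<lambda>x. x \<noteq> y) q"
      using y_notin by (intro takeWhile_append2) auto
    moreover have "dropWhile (\<lambda>x. x \<noteq> y) (p @ q) = dropWhile (\<lambda>x. x \<noteq> y) q"
      using y_notin by (intro dropWhile_append2) auto
    ultimately show ?thesis by (simp add: insert_before_def zs q)
  qed
  ultimately show ?thesis by blast
qed

lemma insert_before_inj:
  assumes "xs \<in> arrangements I n" "xs' \<in> arrangements I n"
    and "y \<in> insert 0 (I \<inter> {1..n})" "y' \<in> insert 0 (I \<inter> {1..n})"
    and eq: "insert_before (Suc n) y xs = insert_before (Suc n) y' xs'"
  shows "xs = xs' \<and> y = y'"
proof -
  have S: "set xs = {1..n}" "set xs' = {1..n}" using assms by (auto simp: arrangements_def)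
  then have "Suc n \<notin> set xs" "Suc n \<notin> set xs'" by auto
  with eq have xs: "xs = xs'" by (metis remove1_insert_before)
  have "dropWhile (\<lambda>x. x \<noteq> y) xs = dropWhile (\<lambda>x. x \<noteq> y') xs"
  proof -
    have notin: "Suc n \<notin> set (takeWhile (\<lambda>x. x \<noteq> z) xs)"
      "Suc n \<notin> set (dropWhile (\<lambda>x. x \<noteq> z) xs)" for z
      using S by (auto dest: set_takeWhileD set_dropWhileD)
    show ?thesis
      using eq unfolding insert_before_def xs[symmetric]
      by (simp add: append_Cons_eq_iff notin)
  qed
  \<comment> \<open>The choice can be read off from the part of the list after the insertion point.\<close>
  moreover have drop: "z = (if dropWhile (\<lambda>x. x \<noteq> z) xs = [] then 0 else hd (dropWhile (\<lambda>x. x \<noteq> z) xs))"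
    if "z \<in> insert 0 (I \<inter> {1..n})" for z
  proof (cases "z = 0")
    case True
    then have "dropWhile (\<lambda>x. x \<noteq> z) xs = []" using S by (auto simp: dropWhile_eq_Nil_conv)
    then show ?thesis using True by simp
  next
    case False
    then have "z \<in> set xs" using that S by auto
    then have "dropWhile (\<lambda>x. x \<noteq> z) xs \<noteq> []" by (auto simp: dropWhile_eq_Nil_conv)
    then show ?thesis using hd_dropWhile[of "\<lambda>x. x \<noteq> z" xs] by auto
  qed
  ultimately have "y = y'" using drop[OF assms(3)] drop[OF assms(4)] by metis
  with xs show ?thesis by simp
qed

lemma card_arrangements:
  "card (arrangements I n) = (\<Prod>j=1..n. card (I \<inter> {1..<j}) + 1)"
proof (induction n)
  case 0
  have "arrangements I 0 = {[]}" by (auto simp: arrangements_def)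
  then show ?case by simp
next
  case (Suc n)
  have "bij_betw (\<lambda>(xs, y). insert_before (Suc n) y xs)
          (arrangements I n \<times> insert 0 (I \<inter> {1..n})) (arrangements I (Suc n))"
    unfolding bij_betw_def
  proof
    show "inj_on (\<lambda>(xs, y). insert_before (Suc n) y xs) (arrangements I n \<times> insert 0 (I \<inter> {1..n}))"
    proof (rule inj_onI, clarify)
      fix xs y xs' y'
      assume "xs \<in> arrangements I n" "xs' \<in> arrangements I n"
        "y \<in> insert 0 (I \<inter> {1..n})" "y' \<in> insert 0 (I \<inter> {1..n})"
        "insert_before (Suc n) y xs = insert_before (Suc n) y' xs'"
      then show "xs = xs' \<and> y = y'" by (rule insert_before_inj)
    qed
    show "(\<lambda>(xs, y). insert_before (Suc n) y xs) ` (arrangements I n \<times> insert 0 (I \<inter> {1..n}))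
            = arrangements I (Suc n)"
    proof (intro equalityI subsetI)
      fix zs
      assume "zs \<in> (\<lambda>(xs, y). insert_before (Suc n) y xs) `
        (arrangements I n \<times> insert 0 (I \<inter> {1..n}))"
      then obtain xs y where "xs \<in> arrangements I n" "y \<in> insert 0 (I \<inter> {1..n})"
        "zs = insert_before (Suc n) y xs" by (elim imageE SigmaE) simp
      then show "zs \<in> arrangements I (Suc n)" using insert_before_arrangement by blast
    next
      fix zs assume "zs \<in> arrangements I (Suc n)"
      then obtain xs y where "xs \<in> arrangements I n" "y \<in> insert 0 (I \<inter> {1..n})"
        "zs = insert_before (Suc n) y xs" using arrangement_remove_max by meson
      then show "zs \<in> (\<lambda>(xs, y). insert_before (Suc n) y xs) `
        (arrangements I n \<times> insert 0 (I \<inter> {1..n}))" by force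
    qed
  qed
  then have "card (arrangements I (Suc n)) = card (arrangements I n) * card (insert 0 (I \<inter> {1..n}))"
    by (metis bij_betw_same_card card_cartesian_product)
  also have "card (insert 0 (I \<inter> {1..n})) = card (I \<inter> {1..<Suc n}) + 1"
    by (simp add: atLeastLessThanSuc_atLeastAtMost)
  finally show ?case using Suc by simp
qed

section \<open>Parking in the spots from 2 to n + 1\<close>

lemma parking_snoc: "parking u (a @ [p]) = parking u a @ [park_car u (parking u a) p]"
  by (simp add: parking_def)

lemma length_parking [simp]: "length (parking u a) = length a"
  by (induction a rule: rev_induct) (auto simp: parking_snoc, simp add: parking_def)

text \<open>
  Since each car only sees those before it, a list of positions is the result of the parking
  process as soon as every entry obeys the parking rule relative to the entries before it.
  This allows a parking result to be verified without following the process.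
\<close>

lemma parking_eq_iff:
  "parking u a = qs \<longleftrightarrow>
     length qs = length a \<and> (\<forall>c<length a. qs ! c = park_car u (take c qs) (a ! c))"
proof (induction a arbitrary: qs rule: rev_induct)
  case Nil
  then show ?case by (auto simp: parking_def)
next
  case (snoc p a)
  show ?case
  proof (cases qs rule: rev_cases)
    case Nil
    then show ?thesis by (auto simp: parking_snoc)
  next
    case (snoc qs' r)
    have "parking u (a @ [p]) = qs \<longleftrightarrow> parking u a = qs' \<and> r = park_car u qs' p"
      by (auto simp: parking_snoc snoc)
    then show ?thesis
      unfolding snoc.IH
      by (auto simp: snoc nth_append less_Suc_eq)
  qed
qed

lemma park_car_eq_Some_iff:
  "park_car u ps p = Some j \<longleftrightarrow>
     p \<le> j \<and> available u ps j \<and> (\<forall>i. p \<le> i \<and> i < j \<longrightarrow> \<not> available u ps i)"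
proof
  assume "park_car u ps p = Some j"
  then have ex: "\<exists>j. p \<le> j \<and> available u ps j" and j: "j = (LEAST j. p \<le> j \<and> available u ps j)"
    by (auto simp: park_car_def split: if_splits)
  show "p \<le> j \<and> available u ps j \<and> (\<forall>i. p \<le> i \<and> i < j \<longrightarrow> \<not> available u ps i)"
    using LeastI_ex[OF ex] not_less_Least[of _ "\<lambda>j. p \<le> j \<and> available u ps j"]
    unfolding j by blast
next
  assume *: "p \<le> j \<and> available u ps j \<and> (\<forall>i. p \<le> i \<and> i < j \<longrightarrow> \<not> available u ps i)"
  then have "(LEAST j. p \<le> j \<and> available u ps j) = j"
    by (intro Least_equality) (auto simp: not_less[symmetric])
  with * show "park_car u ps p = Some j" by (auto simp: park_car_def)
qed

lemma length_shifted: "length [2..<n + 2] = n"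
  unfolding length_upt by simp

lemma count_list_distinct:
  "distinct xs \<Longrightarrow> count_list xs x = (if x \<in> set xs then 1 else 0)"
  by (induction xs) auto

lemma capacity_shifted: "capacity [2..<n + 2] j = (if 2 \<le> j \<and> j < n + 2 then 1 else 0)"
  by (simp add: capacity_def count_list_distinct del: upt_Suc)

lemma available_shifted:
  "available [2..<n + 2] ps j \<longleftrightarrow> 2 \<le> j \<and> j < n + 2 \<and> Some j \<notin> set ps"
  unfolding available_def capacity_shifted by (auto simp: count_list_0_iff)

lemma outcome_shifted:
  assumes "n \<ge> 1"
    and "\<And>s. s \<in> {2..<n + 2} \<Longrightarrow> {c \<in> {1..n}. parking [2..<n + 2] a ! (c - 1) = Some s} = {t s}"
  shows "outcome [2..<n + 2] a = None # map (\<lambda>s. Some {t s}) [2..<n + 2]"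
proof -
  have M: "Max (set [2..<n + 2]) = n + 1"
    using assms(1) by (intro Max_eqI) auto
  have U: "[1..<Suc (n + 1)] = 1 # [2..<n + 2]"
    by (subst upt_conv_Cons) (auto simp: numeral_2_eq_2)
  have no_spot_1: "capacity [2..<n + 2] 1 = 0"
    by (simp only: capacity_shifted) simp
  have "(if capacity [2..<n + 2] s > 0
           then Some {c \<in> {1..n}. parking [2..<n + 2] a ! (c - 1) = Some s} else None) = Some {t s}"
    if "s \<in> set [2..<n + 2]" for s
  proof -
    have s: "s \<in> {2..<n + 2}" using that by (simp only: set_upt)
    then have "capacity [2..<n + 2] s > 0" unfolding capacity_shifted by simp
    with assms(2)[OF s] show ?thesis by (simp only: if_True)
  qed
  then show ?thesis
    unfolding outcome_def M U length_shifted list.map no_spot_1 by (simp del: upt_Suc cong: map_cong)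
qed

text \<open>
  An unlucky car in spot \<open>s + 1 > 2\<close> has driven past spot \<open>s\<close> or started there, so spot \<open>s\<close> was
  already taken by an earlier car. As all spots are filled, the car found in spot \<open>s\<close>
  is thus the smaller one.
\<close>

lemma outcome_in_arrangements:
  assumes n: "n \<ge> 1" and a: "a \<in> PF [2..<n + 2]"
  shows "\<exists>xs \<in> arrangements (Lucky [2..<n + 2] a) n.
           outcome [2..<n + 2] a = None # map (\<lambda>c. Some {c}) xs"
proof -
  define u where "u = [2..<n + 2]"
  define spot where "spot c = the (parking u a ! (c - 1))" for c
  have len: "length a = n" using a by (simp only: PF_def length_shifted mem_Collect_eq)
  have parked: "parking u a ! (c - 1) = Some (spot c)" if "c \<in> {1..n}" for c
  proof -
    have "parking u a ! (c - 1) \<in> set (parking u a)" using that len by (intro nth_mem) auto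
    then have "parking u a ! (c - 1) \<noteq> None"
      using a unfolding PF_def u_def by (metis (mono_tags, lifting) mem_Collect_eq)
    then show ?thesis by (simp add: spot_def)
  qed
  have earlier: "Some s \<in> set (take (c - 1) (parking u a)) \<longleftrightarrow> (\<exists>d\<in>{1..<c}. spot d = s)"
    if "c \<in> {1..n}" for c s
  proof -
    have "Some s \<in> set (take (c - 1) (parking u a)) \<longleftrightarrow> (\<exists>d<c - 1. parking u a ! d = Some s)"
      using that len by (simp add: in_set_conv_nth) (metis (no_types, lifting) less_diff_conv
          less_le_trans nth_take add.right_neutral le_trans diff_le_self)
    also have "\<dots> \<longleftrightarrow> (\<exists>d\<in>{1..<c}. parking u a ! (d - 1) = Some s)"
    proof
      assume "\<exists>d<c - 1. parking u a ! d = Some s"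
      then obtain d where "d < c - 1" "parking u a ! d = Some s" by blast
      then show "\<exists>d\<in>{1..<c}. parking u a ! (d - 1) = Some s"
        by (intro bexI[of _ "Suc d"]) auto
    next
      assume "\<exists>d\<in>{1..<c}. parking u a ! (d - 1) = Some s"
      then obtain d where "d\<in>{1..<c}" "parking u a ! (d - 1) = Some s" by blast
      then show "\<exists>d<c - 1. parking u a ! d = Some s"
        by (intro exI[of _ "d - 1"]) auto
    qed
    also have "\<dots> \<longleftrightarrow> (\<exists>d\<in>{1..<c}. spot d = s)"
      using that parked by (intro bex_cong) auto
    finally show ?thesis .
  qed
  have rule: "a ! (c - 1) \<le> spot c \<and> 2 \<le> spot c \<and> spot c < n + 2 \<and> (\<forall>d\<in>{1..<c}. spot d \<noteq> spot c) \<and>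
      (\<forall>s. a ! (c - 1) \<le> s \<and> s < spot c \<and> 2 \<le> s \<longrightarrow> (\<exists>d\<in>{1..<c}. spot d = s))"
    if c: "c \<in> {1..n}" for c
  proof -
    have "parking u a ! (c - 1) = park_car u (take (c - 1) (parking u a)) (a ! (c - 1))"
      using c len parking_eq_iff[of u a "parking u a"] by auto
    then have *: "park_car u (take (c - 1) (parking u a)) (a ! (c - 1)) = Some (spot c)"
      using parked[OF c] by simp
    note iff = *[unfolded park_car_eq_Some_iff u_def available_shifted, folded u_def,
        unfolded earlier[OF c]]
    from iff have "2 \<le> spot c" "spot c < n + 2" "a ! (c - 1) \<le> spot c"
      "\<forall>d\<in>{1..<c}. spot d \<noteq> spot c" by blast+
    moreover have "\<exists>d\<in>{1..<c}. spot d = s" if "a ! (c - 1) \<le> s" "s < spot c" "2 \<le> s" for s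
    proof -
      have "s < n + 2" using that(2) \<open>spot c < n + 2\<close> by simp
      then show ?thesis using iff that by blast
    qed
    ultimately show ?thesis by blast
  qed
  have inj: "inj_on spot {1..n}"
  proof (rule linorder_inj_onI)
    fix c d assume "c < d" "c \<in> {1..n}" "d \<in> {1..n}"
    then show "spot c \<noteq> spot d" using rule[of d] by auto
  qed auto
  have "spot ` {1..n} \<subseteq> {2..<n + 2}" using rule by auto
  then have img: "spot ` {1..n} = {2..<n + 2}"
    by (rule card_subset_eq[rotated]) (simp_all only: card_image[OF inj] finite_atLeastLessThan, simp)
  \<comment> \<open>\<open>t s\<close> is the car in spot \<open>s\<close>.\<close>
  define t where "t = inv_into {1..n} spot"
  have t: "t s \<in> {1..n}" "spot (t s) = s" if "s \<in> {2..<n + 2}" for s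
    using that img unfolding t_def by (auto intro: inv_into_into f_inv_into_f)
       (metis atLeastAtMost_iff inv_into_into atLeastLessThan_iff)+
  have t_spot: "t (spot c) = c" if "c \<in> {1..n}" for c
    using that inj unfolding t_def by simp
  have bij_t: "bij_betw t {2..<n + 2} {1..n}"
    unfolding t_def by (intro bij_betw_inv_into bij_betw_imageI inj img)
  define xs where "xs = map t [2..<n + 2]"
  have "distinct xs" "set xs = {1..n}"
    using bij_t by (simp_all add: xs_def distinct_map bij_betw_def del: upt_Suc)
  moreover have "successively (\<lambda>c d. d \<in> Lucky u a \<or> c < d) xs"
    unfolding successively_conv_nth
  proof (intro allI impI)
    fix m assume m: "Suc m < length xs"
    \<comment> \<open>Position \<open>m\<close> of \<open>xs\<close> stands for spot \<open>m + 2\<close>.\<close>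
    let ?d = "t (m + 3)"
    have d: "?d \<in> {1..n}" "spot ?d = m + 3" using t[of "m + 3"] m by (auto simp: xs_def simp del: upt_Suc)
    have nth: "xs ! m = t (m + 2)" "xs ! Suc m = ?d"
      using m by (auto simp: xs_def add.commute numeral_3_eq_3 simp del: upt_Suc)
    show "xs ! Suc m \<in> Lucky u a \<or> xs ! m < xs ! Suc m"
    proof (cases "a ! (?d - 1) = spot ?d")
      case True
      then have "?d \<in> Lucky u a" using d parked[OF d(1)] unfolding Lucky_def u_def length_shifted by simp
      then show ?thesis by (simp add: nth)
    next
      case False
      then have "a ! (?d - 1) \<le> m + 2" using rule[OF d(1)] d(2) by auto
      then obtain c where c: "c \<in> {1..<?d}" "spot c = m + 2"
      proof -
        have "m + 2 < spot ?d" "2 \<le> m + 2" using d(2) by auto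
        then show ?thesis using \<open>a ! (?d - 1) \<le> m + 2\<close> rule[OF d(1)] that by blast
      qed
      then have "t (m + 2) = c" using t_spot[of c] d(1) by auto
      then show ?thesis using c nth by simp
    qed
  qed
  ultimately have "xs \<in> arrangements (Lucky u a) n" by (simp add: arrangements_def)
  moreover have "outcome u a = None # map (\<lambda>s. Some {t s}) [2..<n + 2]"
    unfolding u_def
  proof (rule outcome_shifted[OF n])
    fix s assume s: "s \<in> {2..<n + 2}"
    then show "{c \<in> {1..n}. parking [2..<n + 2] a ! (c - 1) = Some s} = {t s}"
      unfolding u_def[symmetric] using t[OF s] t_spot parked by auto
  qed
  ultimately show ?thesis
    unfolding u_def by (auto simp: xs_def o_def intro!: bexI[of _ xs])
qed

text \<open>
  Let the cars in \<open>I\<close> prefer their own spots and all others the spot just before their own. The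
  latter find it unavailable: it is spot 1, or, by the descent condition, taken by an earlier car.
\<close>

lemma arrangement_is_outcome:
  assumes n: "n \<ge> 1" and xs: "xs \<in> arrangements I n" and I: "I \<subseteq> {1..n}"
  shows "\<exists>a \<in> PF [2..<n + 2]. Lucky [2..<n + 2] a = I \<and>
           outcome [2..<n + 2] a = None # map (\<lambda>c. Some {c}) xs"
proof -
  define u where "u = [2..<n + 2]"
  have D: "distinct xs" "set xs = {1..n}" and S: "successively (\<lambda>c d. d \<in> I \<or> c < d) xs"
    using xs by (auto simp: arrangements_def)
  have len: "length xs = n" using D by (metis card_atLeastAtMost diff_Suc_1 distinct_card)
  define t where "t s = xs ! (s - 2)" for s
  have bij_t: "bij_betw t {2..<n + 2} {1..n}"
  proof -
    have "bij_betw (\<lambda>s. s - 2) {2..<n + 2} {..<n}"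
      by (rule bij_betw_byWitness[of _ "\<lambda>i. i + 2"]) auto
    moreover have "bij_betw ((!) xs) {..<n} {1..n}"
      using bij_betw_nth[OF D(1)] len D(2) by auto
    ultimately have "bij_betw ((!) xs \<circ> (\<lambda>s. s - 2)) {2..<n + 2} {1..n}"
      by (rule bij_betw_trans)
    then show ?thesis by (simp add: o_def t_def[abs_def])
  qed
  define spot where "spot = inv_into {2..<n + 2} t"
  have spot: "spot c \<in> {2..<n + 2}" "t (spot c) = c" if "c \<in> {1..n}" for c
    using that bij_t unfolding spot_def
    by (metis bij_betw_imp_surj_on inv_into_into, metis bij_betw_inv_into_right)
  have spot_t: "spot (t s) = s" "t s \<in> {1..n}" if "s \<in> {2..<n + 2}" for s
    using that bij_t unfolding spot_def
    by (metis bij_betw_inv_into_left, metis bij_betwE)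
  define a where "a = map (\<lambda>c. if c \<in> I then spot c else spot c - 1) [1..<n + 1]"
  define qs where "qs = map (\<lambda>c. Some (spot c)) [1..<n + 1]"
  have lens [simp]: "length a = n" "length qs = n" by (auto simp: a_def qs_def)
  have nth: "a ! m = (if Suc m \<in> I then spot (Suc m) else spot (Suc m) - 1)"
      "qs ! m = Some (spot (Suc m))" if "m < n" for m
    using that by (auto simp: a_def qs_def simp del: upt_Suc)
  have parking: "parking u a = qs"
    unfolding parking_eq_iff
  proof (intro conjI allI impI)
    fix m assume "m < length a"
    then have m: "m < n" by simp
    let ?c = "Suc m"
    have c: "spot ?c \<in> {2..<n + 2}" "t (spot ?c) = ?c" using spot[of ?c] m by auto
    have earlier: "Some s \<in> set (take m qs) \<longleftrightarrow> (\<exists>d\<in>{1..m}. spot d = s)" for s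
    proof -
      have "take m qs = map (\<lambda>c. Some (spot c)) [1..<m + 1]"
        using m by (simp add: qs_def take_map take_upt del: upt_Suc)
      then show ?thesis by (auto simp del: upt_Suc)
    qed
    have fresh: "Some (spot ?c) \<notin> set (take m qs)"
    proof
      assume "Some (spot ?c) \<in> set (take m qs)"
      then obtain d where "d \<in> {1..m}" "spot d = spot ?c" using earlier by auto
      then have "d = ?c" using spot(2)[of d] c(2) m by auto
      then show False using \<open>d \<in> {1..m}\<close> by simp
    qed
    have "park_car u (take m qs) (a ! m) = Some (spot ?c)"
      unfolding park_car_eq_Some_iff u_def available_shifted
    proof (intro conjI allI impI)
      show "a ! m \<le> spot ?c" using nth(1)[OF m] by auto
      show "2 \<le> spot ?c" "spot ?c < n + 2" "Some (spot ?c) \<notin> set (take m qs)" 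
        using c fresh by auto
      fix s assume s: "a ! m \<le> s \<and> s < spot ?c"
      show "\<not> (2 \<le> s \<and> s < n + 2 \<and> Some s \<notin> set (take m qs))"
      proof
        assume bad: "2 \<le> s \<and> s < n + 2 \<and> Some s \<notin> set (take m qs)"
        have cI: "?c \<notin> I" and s1: "spot ?c = s + 1"
          using s nth(1)[OF m] by (auto split: if_splits)
        have "t (Suc s) \<in> I \<or> t s < t (Suc s)"
        proof -
          have "Suc (s - 2) = Suc s - 2" "Suc (s - 2) < length xs" using bad c(1) s1 len by auto
          then show ?thesis using S unfolding successively_conv_nth t_def by metis
        qed
        then have "t s < ?c" using c(2) s1 cI by auto
        moreover have "spot (t s) = s" "t s \<in> {1..n}" using spot_t[of s] bad by auto
        ultimately have "Some s \<in> set (take m qs)"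
          unfolding earlier by (intro bexI[of _ "t s"]) auto
        with bad show False by simp
      qed
    qed
    then show "qs ! m = park_car u (take m qs) (a ! m)" using nth(2)[OF m] by simp
  qed simp
  have parked: "parking u a ! (c - 1) = Some (spot c)" if "c \<in> {1..n}" for c
    using that nth(2)[of "c - 1"] by (auto simp: parking)
  have "a \<in> PF u"
  proof -
    have "1 \<le> p" if p: "p \<in> set a" for p
    proof -
      obtain c where "c \<in> {1..n}" "p = (if c \<in> I then spot c else spot c - 1)"
        using p unfolding a_def by (force simp del: upt_Suc)
      then show ?thesis using spot(1)[of c] by auto
    qed
    moreover have "None \<notin> set qs" unfolding qs_def by auto
    ultimately show ?thesis
      unfolding PF_def mem_Collect_eq parking unfolding u_def length_shifted by simp
  qed
  moreover have "Lucky u a = I"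
  proof -
    have "parking u a ! (c - 1) = Some (a ! (c - 1)) \<longleftrightarrow> c \<in> I" if "c \<in> {1..n}" for c
    proof -
      have "a ! (c - 1) = (if c \<in> I then spot c else spot c - 1)"
        using that nth(1)[of "c - 1"] by (cases c) auto
      then show ?thesis using parked[OF that] spot(1)[OF that] by auto
    qed
    then have "Lucky u a = {c \<in> {1..n}. c \<in> I}" unfolding Lucky_def u_def length_shifted by blast
    then show ?thesis using I by auto
  qed
  moreover have "outcome u a = None # map (\<lambda>s. Some {t s}) [2..<n + 2]"
    unfolding u_def
  proof (rule outcome_shifted[OF n])
    fix s assume s: "s \<in> {2..<n + 2}"
    then show "{c \<in> {1..n}. parking [2..<n + 2] a ! (c - 1) = Some s} = {t s}"
      unfolding u_def[symmetric] using spot_t[OF s] spot(2) parked by auto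
  qed
  moreover have "map t [2..<n + 2] = xs"
    by (rule nth_equalityI) (simp_all add: len t_def del: upt_Suc)
  then have "map (\<lambda>s. Some {t s}) [2..<n + 2] = map (\<lambda>c. Some {c}) xs"
    by (metis (no_types, lifting) list.map_comp comp_apply map_eq_conv)
  ultimately show ?thesis unfolding u_def by auto
qed

lemma card_outcomes_shifted:
  assumes "n \<ge> 1" "I \<subseteq> {1..n}"
  shows "card (outcomes [2..<n + 2] I) = (\<Prod>j=1..n. card (I \<inter> {1..<j}) + 1)"
proof -
  have "outcomes [2..<n + 2] I = (\<lambda>xs. None # map (\<lambda>c. Some {c}) xs) ` arrangements I n"
  proof (intro equalityI subsetI)
    fix B assume "B \<in> outcomes [2..<n + 2] I"
    then obtain a where a: "a \<in> PF [2..<n + 2]" "Lucky [2..<n + 2] a = I" "B = outcome [2..<n + 2] a"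
      unfolding outcomes_def by blast
    then show "B \<in> (\<lambda>xs. None # map (\<lambda>c. Some {c}) xs) ` arrangements I n"
      using outcome_in_arrangements[OF assms(1) a(1)] by (metis image_eqI)
  next
    fix B assume "B \<in> (\<lambda>xs. None # map (\<lambda>c. Some {c}) xs) ` arrangements I n"
    then obtain xs where xs: "xs \<in> arrangements I n" "B = None # map (\<lambda>c. Some {c}) xs" by blast
    then show "B \<in> outcomes [2..<n + 2] I"
      using arrangement_is_outcome[OF assms(1) xs(1) assms(2)]
      unfolding outcomes_def mem_Collect_eq by metis
  qed
  moreover have "inj (\<lambda>xs :: nat list. None # map (\<lambda>c. Some {c}) xs)"
    by (auto intro!: injI dest!: map_injective simp: inj_def)
  ultimately show ?thesis
    by (metis card_image card_arrangements inj_on_subset subset_UNIV)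
qed

section \<open>Rewriting the product\<close>

text \<open>
  By induction on \<open>n\<close>: if \<open>n + 1\<close> belongs to \<open>I\<close>, the factor at \<open>n + 1\<close> on the right is the
  number of members of \<open>I\<close> up to \<open>n + 1\<close> and extends the factorial; otherwise it is the
  new factor of the product on the left.
\<close>

lemma fact_times_prod_non_members:
  fixes I :: "nat set"
  shows "fact (card (I \<inter> {1..n})) * (\<Prod>j\<in>{1..n} - I. card (I \<inter> {1..j}) + 1)
     = (\<Prod>j=1..n. card (I \<inter> {1..<j}) + 1)"
proof (induction n)
  case 0
  then show ?case by simp
next
  case (Suc n)
  show ?case
  proof (cases "Suc n \<in> I")
    case True
    then have "I \<inter> {1..Suc n} = insert (Suc n) (I \<inter> {1..n})" "{1..Suc n} - I = {1..n} - I"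
      by (auto simp: le_Suc_eq)
    then show ?thesis using Suc by (simp add: atLeastLessThanSuc_atLeastAtMost algebra_simps)
  next
    case False
    then have "I \<inter> {1..Suc n} = I \<inter> {1..n}" "{1..Suc n} - I = insert (Suc n) ({1..n} - I)"
      by (auto simp: le_Suc_eq)
    then show ?thesis using Suc by (simp add: atLeastLessThanSuc_atLeastAtMost algebra_simps)
  qed
qed

text \<open>
  For \<open>m = 0\<close> and \<open>m = k\<close> one of the two bounds on \<open>j\<close> is void, which covers the positions before
  the first and after the last member of \<open>I\<close>.
\<close>

lemma card_initial_part:
  fixes i :: "nat \<Rightarrow> nat"
  assumes "strict_mono_on {1..k} i" "1 \<le> i 1" "m \<le> k"
    and "1 \<le> m \<Longrightarrow> i m < j" "m < k \<Longrightarrow> j \<le> i (Suc m)"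
  shows "card (i ` {1..k} \<inter> {1..<j}) = m"
proof -
  have "mono_on {1..k} i" using assms(1) by (rule strict_mono_on_imp_mono_on)
  then have mono: "i p \<le> i q" if "1 \<le> p" "p \<le> q" "q \<le> k" for p q
    using that by (auto simp: mono_on_def)
  have "i ` {1..k} \<inter> {1..<j} = i ` {1..m}"
  proof (intro equalityI subsetI)
    fix x assume "x \<in> i ` {1..k} \<inter> {1..<j}"
    then obtain l where l: "x = i l" "1 \<le> l" "l \<le> k" "i l < j" by auto
    have "l \<le> m"
    proof (rule ccontr)
      assume "\<not> l \<le> m"
      then show False using mono[of "Suc m" l] l assms(5) by auto
    qed
    then show "x \<in> i ` {1..m}" using l by auto
  next
    fix x assume "x \<in> i ` {1..m}"
    then obtain l where l: "x = i l" "1 \<le> l" "l \<le> m" by auto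
    then show "x \<in> i ` {1..k} \<inter> {1..<j}"
      using mono[of 1 l] mono[of l m] assms by auto
  qed
  moreover have "inj_on i {1..m}"
    by (rule inj_on_subset[OF strict_mono_on_imp_inj_on[OF assms(1)]]) (use assms(3) in simp)
  ultimately show ?thesis by (simp add: card_image)
qed

lemma prod_interval_split:
  fixes f :: "nat \<Rightarrow> nat"
  assumes "a \<le> b" "\<And>j. a < j \<Longrightarrow> j \<le> b \<Longrightarrow> f j = x"
  shows "(\<Prod>j=1..b. f j) = (\<Prod>j=1..a. f j) * x ^ (b - a)"
proof -
  have "{1..b} = {1..a} \<union> {a<..b}" using assms(1) by auto
  then have "(\<Prod>j=1..b. f j) = (\<Prod>j=1..a. f j) * (\<Prod>j\<in>{a<..b}. f j)"
    by (simp only:) (rule prod.union_disjoint, auto)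
  also have "(\<Prod>j\<in>{a<..b}. f j) = x ^ (b - a)" using assms(2) by simp
  finally show ?thesis .
qed

lemma prod_grouped:
  fixes i :: "nat \<Rightarrow> nat"
  assumes mono: "strict_mono_on {1..k} i" and i1: "1 \<le> i 1" and k: "1 \<le> k" and n: "i k \<le> n"
  shows "(\<Prod>j=1..n. card (i ` {1..k} \<inter> {1..<j}) + 1)
           = (\<Prod>l=2..k. l ^ (i l - i (l - 1))) * (k + 1) ^ (n - i k)"
proof -
  let ?f = "\<lambda>j. card (i ` {1..k} \<inter> {1..<j}) + 1"
  have upto: "(\<Prod>j=1..i m. ?f j) = (\<Prod>l=2..m. l ^ (i l - i (l - 1)))" if "1 \<le> m" "m \<le> k" for m
    using that
  proof (induction m rule: dec_induct)
    case base
    have "?f j = 1" if "j \<in> {1..i 1}" for j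
      using card_initial_part[OF mono i1, of 0 j] that by simp
    then show ?case by simp
  next
    case (step m)
    have "i m \<le> i (Suc m)"
      using mono step by (auto simp: strict_mono_on_def intro!: less_imp_le)
    moreover have "?f j = Suc m" if "i m < j" "j \<le> i (Suc m)" for j
      using card_initial_part[OF mono i1, of m j] that step by simp
    ultimately have "(\<Prod>j=1..i (Suc m). ?f j) = (\<Prod>j=1..i m. ?f j) * Suc m ^ (i (Suc m) - i m)"
      by (rule prod_interval_split)
    then show ?case using step by simp
  qed
  have "?f j = k + 1" if "i k < j" for j
    using card_initial_part[OF mono i1, of k j] that by simp
  then have "(\<Prod>j=1..n. ?f j) = (\<Prod>j=1..i k. ?f j) * (k + 1) ^ (n - i k)"
    using n by (intro prod_interval_split) auto
  then show ?thesis using upto[OF k] by simp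
qed

section \<open>The number of outcomes of a lucky set\<close>

theorem theorem3p11:
  fixes n k :: nat and i :: "nat \<Rightarrow> nat" and I :: "nat set" and u :: "nat list"
  assumes "u = [2..<n + 2]"
    and "lucky_set u I"
    and "k \<ge> 1"
    and "I = i ` {1..k}"
    and "strict_mono_on {1..k} i"
    and "1 \<le> i 1" and "i k \<le> n"
  shows "card (outcomes u I) = fact k * (\<Prod>j\<in>{1..n} - I. card (I \<inter> {1..j}) + 1)
    \<and> fact k * (\<Prod>j\<in>{1..n} - I. card (I \<inter> {1..j}) + 1)
        = (\<Prod>l=2..k. l ^ (i l - i (l - 1))) * (k + 1) ^ (n - i k)"
proof -
  have I: "I \<subseteq> {1..n}" using assms(2) unfolding assms(1) lucky_set_def Lucky_def length_shifted by blast
  have "i k \<in> I" using assms(3,4) by auto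
  then have n: "n \<ge> 1" using I by auto
  have "inj_on i {1..k}" using assms(5) by (rule strict_mono_on_imp_inj_on)
  then have "card (I \<inter> {1..n}) = k" using I assms(4) by (simp add: card_image Int_absorb2)
  then have "fact k * (\<Prod>j\<in>{1..n} - I. card (I \<inter> {1..j}) + 1)
      = (\<Prod>j=1..n. card (I \<inter> {1..<j}) + 1)"
    using fact_times_prod_non_members[of I n] by simp
  moreover have "\<dots> = (\<Prod>l=2..k. l ^ (i l - i (l - 1))) * (k + 1) ^ (n - i k)"
    unfolding assms(4) using assms by (intro prod_grouped) auto
  ultimately show ?thesis using card_outcomes_shifted[OF n I] assms(1) by simp
qed

end
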